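(* Let $\Gamma$ be the graph on vertices $v_0,\dots,v_{19}$ (indices mod $20$) which is the edge-disjoint union of the Hamilton cycle $\Sigma=(v_0v_1v_2\cdots v_{19})$, the two pentagons $P_0=(v_0v_4v_8v_{12}v_{16})$ and $P_1=(v_2v_6v_{10}v_{14}v_{18})$, and the two pentagrams $Q_0=(v_1v_9v_{17}v_5v_{13})$ and $Q_1=(v_3v_{11}v_{19}v_7v_{15})$ (each written as a cyclic sequence of vertices, consecutive ones adjacent). Then $\Gamma$ is a $20$-vertex $4$-regular graph of girth $5$. Let $F_0^0=\{v_0v_1,v_4v_5,v_8v_9,v_{12}v_{13},v_{16}v_{17}\}$, $F_0^1=\{v_0v_{19},v_4v_3,v_8v_7,v_{12}v_{11},v_{16}v_{15}\}$, $F_1^0=\{v_2v_1,v_6v_5,v_{10}v_9,v_{14}v_{13},v_{18}v_{17}\}$, $F_1^1=\{v_2v_3,v_6v_7,v_{10}v_{11},v_{14}v_{15},v_{18}v_{19}\}$. Then $E(\Sigma)=F_0^0\cup F_0^1\cup F_1^0\cup F_1^1$, and for each $i,j\in\{0,1\}$ the subgraph $P_i\cup Q_j\cup F_i^j$ is isomorphic to the Petersen graph. Consider the following coloring with colors $\{0,1,2,3,4\}$: vertex $v_i$ gets color $(2-i)\bmod 5$; the edge $v_iv_{i+1}$ of $\Sigma$ gets color $c_{i \bmod 10}$ where $(c_0,\dots,c_9)=(3,4,1,2,4,0,2,3,0,1)$; the edges $v_0v_4,v_4v_8,v_8v_{12},v_{12}v_{16},v_{16}v_0$ get colors $0,1,2,3,4$;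 the edges $v_2v_6,v_6v_{10},v_{10}v_{14},v_{14}v_{18},v_{18}v_2$ get colors $3,4,0,1,2$; the edges $v_1v_9,v_9v_{17},v_{17}v_5,v_5v_{13},v_{13}v_1$ get colors $2,4,1,3,0$; the edges $v_3v_{11},v_{11}v_{19},v_{19}v_7,v_7v_{15},v_{15}v_3$ get colors $0,2,4,1,3$. This is a total coloring of $\Gamma$ that is not efficient. Moreover, $\Gamma$ contains exactly $54$ cycles of length $5$, of which exactly $14$ have both their vertex set and their edge set in bijective correspondence with the color set $\{0,1,2,3,4\}$ under this coloring; the remaining $40$ five-cycles do not have this property.
   Context: A total coloring (TC) assigns colors to vertices and edges so that adjacent vertices, edges sharing an endpoint, and an edge and its endpoints all receive different colors. For a connected $k$-regular graph, a TC with colors $\{0,\dots,k\}$ is efficient if for every vertex $v$ the vertices of the closed neighborhood $N[v]$ receive pairwise distinct colors and each vertex color class is an efficient dominating set (independent set $S$ such that every vertex outside $S$ has exactly one neighbor in $S$). Here $k=4$. *)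

theory Defs
  imports "HOL-Library.Extended_Nat"
begin

section \<open>Finite simple graphs\<close>

record 'a ugraph =
  verts :: "'a set"
  edges :: "'a set set"

definition simple_graph :: "'a ugraph \<Rightarrow> bool" where
  "simple_graph G \<longleftrightarrow>
     finite (verts G) \<and> (\<forall>e \<in> edges G. e \<subseteq> verts G \<and> card e = 2)"

definition subgraph :: "'a ugraph \<Rightarrow> 'a ugraph \<Rightarrow> bool" where
  "subgraph H G \<longleftrightarrow> verts H \<subseteq> verts G \<and> edges H \<subseteq> edges G"

definition graph_union :: "'a ugraph \<Rightarrow> 'a ugraph \<Rightarrow> 'a ugraph" (infixl "\<union>\<^sub>g" 65) where
  "G \<union>\<^sub>g H = \<lparr> verts = verts G \<union> verts H, edges = edges G \<union> edges H \<rparr>"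

text \<open>The graph consisting of the edges in \<open>F\<close> and their endpoints.\<close>

definition edge_graph :: "'a set set \<Rightarrow> 'a ugraph" where
  "edge_graph F = \<lparr> verts = \<Union>F, edges = F \<rparr>"

definition nbhd :: "'a ugraph \<Rightarrow> 'a \<Rightarrow> 'a set" where
  "nbhd G v = {u \<in> verts G. {v, u} \<in> edges G}"

definition closed_nbhd :: "'a ugraph \<Rightarrow> 'a \<Rightarrow> 'a set" where
  "closed_nbhd G v = insert v (nbhd G v)"

definition regular :: "nat \<Rightarrow> 'a ugraph \<Rightarrow> bool" where
  "regular k G \<longleftrightarrow> (\<forall>v \<in> verts G. card (nbhd G v) = k)"

definition graph_connected :: "'a ugraph \<Rightarrow> bool" where
  "graph_connected G \<longleftrightarrow> verts G \<noteq> {} \<and>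
     (\<forall>u \<in> verts G. \<forall>v \<in> verts G. (u, v) \<in> {(x, y). {x, y} \<in> edges G}\<^sup>*)"

definition graph_iso :: "'a ugraph \<Rightarrow> 'b ugraph \<Rightarrow> bool" where
  "graph_iso G H \<longleftrightarrow> (\<exists>f. bij_betw f (verts G) (verts H) \<and>
     (\<forall>u \<in> verts G. \<forall>v \<in> verts G. {u, v} \<in> edges G \<longleftrightarrow> {f u, f v} \<in> edges H))"

text \<open>The Petersen graph as the Kneser graph of the 2-subsets of a 5-element set.\<close>

definition petersen :: "nat set ugraph" where
  "petersen = \<lparr> verts = {A. A \<subseteq> {0..<5} \<and> card A = 2},
                edges = {{A, B} |A B. A \<subseteq> {0..<5} \<and> card A = 2 \<and>
                                      B \<subseteq> {0..<5} \<and> card B = 2 \<and> A \<inter> B = {}} \<rparr>"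

section \<open>Cycles\<close>

definition cycle_edge_list :: "'a list \<Rightarrow> 'a set list" where
  "cycle_edge_list xs = map (\<lambda>i. {xs ! i, xs ! (Suc i mod length xs)}) [0..<length xs]"

definition cycle_of :: "'a list \<Rightarrow> 'a ugraph" where
  "cycle_of xs = \<lparr> verts = set xs, edges = set (cycle_edge_list xs) \<rparr>"

text \<open>Cycles are subgraphs, so a cycle does not depend on a starting point or a direction.\<close>

definition is_cycle :: "'a ugraph \<Rightarrow> bool" where
  "is_cycle C \<longleftrightarrow> (\<exists>xs. distinct xs \<and> 3 \<le> length xs \<and> C = cycle_of xs)"

definition cycles :: "'a ugraph \<Rightarrow> 'a ugraph set" where
  "cycles G = {C. is_cycle C \<and> subgraph C G}"

definition cycles_of_length :: "nat \<Rightarrow> 'a ugraph \<Rightarrow> 'a ugraph set" where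
  "cycles_of_length n G = {C \<in> cycles G. card (edges C) = n}"

definition hamilton_cycle :: "'a ugraph \<Rightarrow> 'a ugraph \<Rightarrow> bool" where
  "hamilton_cycle C G \<longleftrightarrow> C \<in> cycles G \<and> verts C = verts G"

text \<open>The girth of an acyclic graph is \<open>\<infinity>\<close>.\<close>

definition girth :: "'a ugraph \<Rightarrow> enat" where
  "girth G = (INF C \<in> cycles G. enat (card (edges C)))"

section \<open>Total colorings\<close>

definition total_coloring ::
  "'a ugraph \<Rightarrow> 'c set \<Rightarrow> ('a \<Rightarrow> 'c) \<Rightarrow> ('a set \<Rightarrow> 'c) \<Rightarrow> bool" where
  "total_coloring G K vc ec \<longleftrightarrow>
     (\<forall>v \<in> verts G. vc v \<in> K) \<and>
     (\<forall>e \<in> edges G. ec e \<in> K) \<and>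
     (\<forall>u \<in> verts G. \<forall>v \<in> verts G. {u, v} \<in> edges G \<longrightarrow> vc u \<noteq> vc v) \<and>
     (\<forall>e \<in> edges G. \<forall>f \<in> edges G. e \<noteq> f \<and> e \<inter> f \<noteq> {} \<longrightarrow> ec e \<noteq> ec f) \<and>
     (\<forall>e \<in> edges G. \<forall>v \<in> e. ec e \<noteq> vc v)"

definition efficient_dominating_set :: "'a ugraph \<Rightarrow> 'a set \<Rightarrow> bool" where
  "efficient_dominating_set G S \<longleftrightarrow>
     S \<subseteq> verts G \<and>
     (\<forall>u \<in> S. \<forall>v \<in> S. {u, v} \<notin> edges G) \<and>
     (\<forall>v \<in> verts G - S. card (nbhd G v \<inter> S) = 1)"

text \<open>Only meaningful for a connected \<open>k\<close>-regular graph \<open>G\<close>.\<close>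

definition efficient_total_coloring ::
  "'a ugraph \<Rightarrow> nat \<Rightarrow> ('a \<Rightarrow> nat) \<Rightarrow> ('a set \<Rightarrow> nat) \<Rightarrow> bool" where
  "efficient_total_coloring G k vc ec \<longleftrightarrow>
     total_coloring G {0..k} vc ec \<and>
     (\<forall>v \<in> verts G. inj_on vc (closed_nbhd G v)) \<and>
     (\<forall>c \<in> {0..k}. efficient_dominating_set G {v \<in> verts G. vc v = c})"

section \<open>The graph \<open>\<Gamma>\<close> and its coloring\<close>

text \<open>The vertex \<open>v\<^sub>i\<close> is the number \<open>i \<in> {0..<20}\<close>.\<close>

definition Sigma_vs :: "nat list" where
  "Sigma_vs = [0..<20]"

definition P_vs :: "nat \<Rightarrow> nat list" where
  "P_vs i = (if i = 0 then [0, 4, 8, 12, 16] else [2, 6, 10, 14, 18])"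

definition Q_vs :: "nat \<Rightarrow> nat list" where
  "Q_vs j = (if j = 0 then [1, 9, 17, 5, 13] else [3, 11, 19, 7, 15])"

definition Sigma_cycle :: "nat ugraph" where
  "Sigma_cycle = cycle_of Sigma_vs"

definition P :: "nat \<Rightarrow> nat ugraph" where
  "P i = cycle_of (P_vs i)"

definition Q :: "nat \<Rightarrow> nat ugraph" where
  "Q j = cycle_of (Q_vs j)"

definition Gamma :: "nat ugraph" where
  "Gamma = Sigma_cycle \<union>\<^sub>g P 0 \<union>\<^sub>g P 1 \<union>\<^sub>g Q 0 \<union>\<^sub>g Q 1"

definition F :: "nat \<Rightarrow> nat \<Rightarrow> nat set set" where
  "F i j =
     (if i = 0 then
        if j = 0 then {{0, 1}, {4, 5}, {8, 9}, {12, 13}, {16, 17}}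
        else {{0, 19}, {4, 3}, {8, 7}, {12, 11}, {16, 15}}
      else
        if j = 0 then {{2, 1}, {6, 5}, {10, 9}, {14, 13}, {18, 17}}
        else {{2, 3}, {6, 7}, {10, 11}, {14, 15}, {18, 19}})"

definition vcol :: "nat \<Rightarrow> nat" where
  "vcol i = nat ((2 - int i) mod 5)"

text \<open>Each of the five cycles is paired with the colors of its edges, in the same cyclic
  order: the \<open>i\<close>-th color belongs to the edge joining the \<open>i\<close>-th vertex to the next one.\<close>

definition ecol_table :: "(nat set \<times> nat) list" where
  "ecol_table =
     zip (cycle_edge_list Sigma_vs) (map (\<lambda>i. [3, 4, 1, 2, 4, 0, 2, 3, 0, 1] ! (i mod 10)) [0..<20]) @
     zip (cycle_edge_list (P_vs 0)) [0, 1, 2, 3, 4] @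
     zip (cycle_edge_list (P_vs 1)) [3, 4, 0, 1, 2] @
     zip (cycle_edge_list (Q_vs 0)) [2, 4, 1, 3, 0] @
     zip (cycle_edge_list (Q_vs 1)) [0, 2, 4, 1, 3]"

definition ecol :: "nat set \<Rightarrow> nat" where
  "ecol e = the (map_of ecol_table e)"

text \<open>No edge occurs twice in the table, and every edge of \<open>\<Gamma>\<close> occurs.\<close>

lemma distinct_ecol_table: "distinct (map fst ecol_table)"
  by code_simp

lemma edges_Gamma: "edges Gamma = set (map fst ecol_table)"
  by code_simp

text \<open>The vertices, and likewise the edges, of \<open>C\<close> correspond bijectively to the colors.\<close>

definition rainbow :: "'c set \<Rightarrow> ('a \<Rightarrow> 'c) \<Rightarrow> ('a set \<Rightarrow> 'c) \<Rightarrow> 'a ugraph \<Rightarrow> bool" where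
  "rainbow K vc ec C \<longleftrightarrow> bij_betw vc (verts C) K \<and> bij_betw ec (edges C) K"

end

theory Submission
  imports Defs
begin

text \<open>All claims about the concrete graph are finite. The only ones that quantify over an infinite
  domain concern cycles, which are given by arbitrary vertex lists. A rotation and possibly a
  reversal bring such a list into a normal form, and the normal forms of a given length are found
  by extending paths along neighbour lists. A five-cycle of \<open>\<Gamma>\<close> turns out to be determined by its
  vertex set, so that distinct normal forms are told apart by sorting them.\<close>

section \<open>Cycles as lists\<close>

fun path_edges :: "'a list \<Rightarrow> 'a set list" where
  "path_edges (x # y # zs) = {x, y} # path_edges (y # zs)"
| "path_edges _ = []"

text \<open>The cut vertex \<open>y\<close> is kept in both pieces, so no edge is lost
  there.\<close>

lemma path_edges_append:
  "path_edges (xs @ y # ys) = path_edges (xs @ [y]) @ path_edges (y # ys)"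
  by (induction xs rule: path_edges.induct) auto

lemma path_edges_rev: "set (path_edges (rev xs)) = set (path_edges xs)"
proof (induction xs rule: path_edges.induct)
  case (1 x y zs)
  then show ?case
    using path_edges_append[of "rev zs" y "[x]"] by (simp add: insert_commute)
qed auto

lemma path_edges_conv_nth:
  "path_edges xs = map (\<lambda>i. {xs ! i, xs ! Suc i}) [0..<length xs - 1]"
proof (induction xs rule: path_edges.induct)
  case (1 x y zs)
  have "[0..<length (x # y # zs) - 1] = 0 # map Suc [0..<length zs]"
    by (simp add: upt_conv_Cons map_Suc_upt del: upt_Suc)
  with 1 show ?case
    by (simp add: comp_def)
qed auto

text \<open>Repeating the first vertex at the end replaces the index modulo the length by a path,
  which suits list induction.\<close>

lemma cycle_edge_list_Cons: "cycle_edge_list (x # xs) = path_edges (x # xs @ [x])"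
proof -
  have "(x # xs @ [x]) ! i = (x # xs) ! i \<and>
      (x # xs @ [x]) ! Suc i = (x # xs) ! (Suc i mod Suc (length xs))"
    if "i < Suc (length xs)" for i
  proof (cases "Suc i = Suc (length xs)")
    case False
    with that show ?thesis
      by (cases i) (simp_all add: nth_append)
  qed (auto simp: nth_append nth_Cons')
  then show ?thesis
    unfolding cycle_edge_list_def path_edges_conv_nth by simp
qed

lemma edges_cycle_of:
  assumes "xs \<noteq> []"
  shows "edges (cycle_of xs) = insert {last xs, hd xs} (set (path_edges xs))"
proof -
  obtain y ys where xs: "xs = y # ys"
    using assms by (cases xs) auto
  have "y # ys @ [y] = butlast xs @ last xs # [y]"
    using append_butlast_last_id[OF assms] xs by (metis append.assoc append_Cons append_Nil)
  then have "path_edges (y # ys @ [y]) = path_edges (butlast xs @ last xs # [y])"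
    by (rule arg_cong)
  also have "\<dots> = path_edges xs @ [{last xs, y}]"
    using path_edges_append[of "butlast xs" "last xs" "[y]"] xs by simp
  finally show ?thesis
    by (simp add: cycle_of_def cycle_edge_list_Cons xs)
qed

lemma verts_cycle_of [simp]: "verts (cycle_of xs) = set xs"
  by (simp add: cycle_of_def)

lemma cycle_of_eqI:
  "set xs = set ys \<Longrightarrow> edges (cycle_of xs) = edges (cycle_of ys) \<Longrightarrow> cycle_of xs = cycle_of ys"
  by (simp add: cycle_of_def)

text \<open>Rotation invariance: both edge lists consist of the same two paths, from
  \<open>x\<close> to \<open>y\<close> and from \<open>y\<close> back to \<open>x\<close>, in
  opposite orders.\<close>

lemma cycle_of_append_commute: "cycle_of (xs @ ys) = cycle_of (ys @ xs)"
proof (cases "xs = [] \<or> ys = []")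
  case False
  then obtain x xs' y ys' where eq: "xs = x # xs'" "ys = y # ys'"
    by (auto simp: neq_Nil_conv)
  have "path_edges (x # xs' @ y # ys' @ [x]) = path_edges (x # xs' @ [y]) @ path_edges (y # ys' @ [x])"
    using path_edges_append[of "x # xs'" y "ys' @ [x]"] by simp
  moreover have "path_edges (y # ys' @ x # xs' @ [y]) =
      path_edges (y # ys' @ [x]) @ path_edges (x # xs' @ [y])"
    using path_edges_append[of "y # ys'" x "xs' @ [y]"] by simp
  ultimately have "set (cycle_edge_list (xs @ ys)) = set (cycle_edge_list (ys @ xs))"
    by (auto simp: eq cycle_edge_list_Cons)
  then show ?thesis
    by (auto simp: cycle_of_def)
qed auto

lemma cycle_of_rev: "cycle_of (rev xs) = cycle_of xs"
proof (cases "xs = []")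
  case False
  then show ?thesis
    by (intro cycle_of_eqI)
      (simp_all add: edges_cycle_of path_edges_rev last_rev hd_rev insert_commute)
qed simp

text \<open>Two different positions with the same edge would be cyclic successors of each other,
  which is impossible on at least three vertices.\<close>

lemma distinct_cycle_edge_list:
  assumes "distinct xs" "3 \<le> length xs"
  shows "distinct (cycle_edge_list xs)"
proof -
  define n where "n = length xs"
  have "i = j" if eq: "{xs ! i, xs ! (Suc i mod n)} = {xs ! j, xs ! (Suc j mod n)}"
    and ij: "i < n" "j < n" for i j
  proof (rule ccontr)
    assume "i \<noteq> j"
    moreover have "Suc i mod n < n" "Suc j mod n < n"
      using ij by auto
    \<comment> \<open>As \<open>i\<close> and \<open>j\<close> differ, the two doubletons can only
      agree crosswise.\<close>
    ultimately have "i = Suc j mod n" "j = Suc i mod n"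
      using eq ij assms(1) by (auto simp: doubleton_eq_iff nth_eq_iff_index_eq n_def)
    moreover have "Suc k mod n = (if Suc k = n then 0 else Suc k)" if "k < n" for k
      using that by (simp add: mod_Suc)
    ultimately show False
      using ij assms(2) \<open>i \<noteq> j\<close> by (auto simp: n_def split: if_splits)
  qed
  then show ?thesis
    by (auto simp: cycle_edge_list_def distinct_map inj_on_def n_def)
qed

lemma card_edges_cycle_of:
  assumes "distinct xs" "3 \<le> length xs"
  shows "card (edges (cycle_of xs)) = length xs"
  using distinct_card[OF distinct_cycle_edge_list[OF assms]]
  by (simp add: cycle_of_def cycle_edge_list_def)

text \<open>Rotate the minimum to the end; if its two neighbours on the cycle are then in the wrong
  order, reverse the rest.\<close>

lemma cycle_of_normal_form:
  fixes xs :: "'a::linorder list"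
  assumes "distinct xs" "3 \<le> length xs"
  obtains ys where "cycle_of ys = cycle_of xs" "distinct ys" "length ys = length xs"
    "\<forall>y \<in> set (butlast ys). last ys < y" "hd ys < last (butlast ys)"
proof -
  define m where "m = Min (set xs)"
  have "m \<in> set xs"
    using assms(2) unfolding m_def by (intro Min_in) auto
  then obtain as bs where xs: "xs = as @ m # bs"
    by (auto simp: in_set_conv_decomp)
  define zs where "zs = bs @ as"
  have xs': "cycle_of xs = cycle_of (zs @ [m])"
    using cycle_of_append_commute[of "as @ [m]" bs] by (simp add: xs zs_def)
  have len: "Suc (length zs) = length xs" and dist: "distinct (zs @ [m])"
    using assms(1) by (auto simp: xs zs_def)
  have min: "m < z" if "z \<in> set zs" for z
  proof -
    have "z \<in> set xs" "z \<noteq> m"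
      using that dist by (auto simp: xs zs_def)
    then show ?thesis
      using Min_le[of "set xs" z] by (simp add: m_def less_le)
  qed
  have "zs \<noteq> []" "2 \<le> length zs"
    using len assms(2) by auto
  \<comment> \<open>These are the two neighbours of \<open>m\<close> on the cycle; they differ
    because at least two vertices remain besides \<open>m\<close>.\<close>
  then have "hd zs \<noteq> last zs"
    using dist by (simp add: hd_conv_nth last_conv_nth nth_eq_iff_index_eq)
  then consider "hd zs < last zs" | "last zs < hd zs"
    by force
  then show thesis
  proof cases
    case 1
    then show thesis
      using that[of "zs @ [m]"] xs' len dist min \<open>zs \<noteq> []\<close> by (simp add: hd_append)
  next
    case 2
    \<comment> \<open>Reversal moves \<open>m\<close> to the front, and a rotation brings it back to
      the end.\<close>
    have "cycle_of (rev zs @ [m]) = cycle_of xs"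
      using cycle_of_rev[of "zs @ [m]"] cycle_of_append_commute[of "[m]" "rev zs"] xs' by simp
    then show thesis
      using that[of "rev zs @ [m]"] len dist min \<open>zs \<noteq> []\<close> 2 by (simp add: hd_append hd_rev last_rev)
  qed
qed

section \<open>Cycles as subgraphs\<close>

lemma path_edges_subset_iff:
  "set (path_edges xs) \<subseteq> E \<longleftrightarrow> successively (\<lambda>x y. {x, y} \<in> E) xs"
  by (induction xs rule: path_edges.induct) auto

text \<open>Only edges have to be checked: every vertex of the cycle lies on one of its edges, and
  edges of a simple graph stay inside its vertex set.\<close>

lemma subgraph_cycle_of_iff:
  assumes "simple_graph G" "xs \<noteq> []"
  shows "subgraph (cycle_of xs) G \<longleftrightarrow>
    {last xs, hd xs} \<in> edges G \<and> successively (\<lambda>x y. {x, y} \<in> edges G) xs"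
proof -
  have "xs ! i \<in> \<Union> (edges (cycle_of xs))" if "i < length xs" for i
    using that by (auto simp: cycle_of_def cycle_edge_list_def)
  then have "set xs \<subseteq> \<Union> (edges (cycle_of xs))"
    by (auto simp: set_conv_nth)
  moreover have "\<Union> (edges G) \<subseteq> verts G"
    using assms(1) by (auto simp: simple_graph_def)
  ultimately have "edges (cycle_of xs) \<subseteq> edges G \<Longrightarrow> set xs \<subseteq> verts G"
    by blast
  then have "subgraph (cycle_of xs) G \<longleftrightarrow> edges (cycle_of xs) \<subseteq> edges G"
    by (auto simp: subgraph_def)
  then show ?thesis
    using assms(2) by (simp add: edges_cycle_of path_edges_subset_iff)
qed

lemma cycles_of_length_conv:
  "cycles_of_length n G =
    {cycle_of xs |xs. distinct xs \<and> 3 \<le> length xs \<and> length xs = n \<and> subgraph (cycle_of xs) G}"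
  by (auto simp: cycles_of_length_def cycles_def is_cycle_def card_edges_cycle_of)

section \<open>Enumerating cycles\<close>

text \<open>Paths grow at the head, so the start vertex stays last and can be compared with each new
  vertex at once. After \<open>n\<close> extensions a path has \<open>n + 1\<close>
  vertices.\<close>

primrec paths_above_last :: "'a::linorder list \<Rightarrow> ('a \<Rightarrow> 'a list) \<Rightarrow> nat \<Rightarrow> 'a list list" where
  "paths_above_last vs N 0 = map (\<lambda>v. [v]) vs"
| "paths_above_last vs N (Suc n) = concat (map (\<lambda>p. map (\<lambda>x. x # p)
     (filter (\<lambda>x. x \<notin> set p \<and> last p < x) (N (hd p)))) (paths_above_last vs N n))"

lemma set_paths_above_last:
  "set (paths_above_last vs N n) =
    {p. length p = Suc n \<and> distinct p \<and> last p \<in> set vs \<and>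
        (\<forall>x \<in> set (butlast p). last p < x) \<and> successively (\<lambda>x y. x \<in> set (N y)) p}"
proof (induction n)
  case 0
  show ?case
    by (auto simp: length_Suc_conv)
next
  case (Suc n)
  have "p \<in> set (paths_above_last vs N (Suc n)) \<longleftrightarrow> length p = Suc (Suc n) \<and> distinct p \<and>
      last p \<in> set vs \<and> (\<forall>x \<in> set (butlast p). last p < x) \<and>
      successively (\<lambda>x y. x \<in> set (N y)) p" for p
  proof (cases "2 \<le> length p")
    case True
    then obtain x q where p: "p = x # q" "q \<noteq> []"
      by (auto simp: Suc_le_length_iff numeral_2_eq_2)
    have "p \<in> set (paths_above_last vs N (Suc n)) \<longleftrightarrow>
        q \<in> set (paths_above_last vs N n) \<and> x \<notin> set q \<and> last q < x \<and> x \<in> set (N (hd q))"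
      by (auto simp: p)
    then show ?thesis
      using p by (auto simp: Suc successively_Cons)
  next
    case False
    then have "length q \<noteq> Suc n" if "p = x # q" for x q
      using that by auto
    with False show ?thesis
      by (auto simp: Suc)
  qed
  then show ?case
    by blast
qed

text \<open>Each cycle is listed once: its smallest vertex comes last, and the direction is
  fixed by comparing the two neighbours of that vertex on the cycle.\<close>

definition cycle_lists :: "'a::linorder list \<Rightarrow> ('a \<Rightarrow> 'a list) \<Rightarrow> nat \<Rightarrow> 'a list list" where
  "cycle_lists vs N n = filter (\<lambda>p. last p \<in> set (N (hd p)) \<and> hd p < last (butlast p))
     (paths_above_last vs N (n - 1))"

lemma set_cycle_lists:
  assumes "simple_graph G" "verts G = set vs" "\<And>u v. {u, v} \<in> edges G \<longleftrightarrow> v \<in> set (N u)" "0 < n"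
  shows "set (cycle_lists vs N n) =
    {p. length p = n \<and> distinct p \<and> (\<forall>x \<in> set (butlast p). last p < x) \<and>
        hd p < last (butlast p) \<and> subgraph (cycle_of p) G}"
proof -
  have adj: "x \<in> set (N y) \<longleftrightarrow> {x, y} \<in> edges G" for x y
    using assms(3)[of y x] by (simp add: insert_commute)
  have vs: "{x, y} \<in> edges G \<Longrightarrow> x \<in> set vs" for x y
    using assms(1,2) by (auto simp: simple_graph_def)
  \<comment> \<open>The closing edge already forces \<open>last p\<close> to be a vertex of
    \<open>G\<close>.\<close>
  have sub: "subgraph (cycle_of p) G \<longleftrightarrow> last p \<in> set vs \<and> last p \<in> set (N (hd p)) \<and>
      successively (\<lambda>x y. x \<in> set (N y)) p" if "length p = n" for p
    using that assms(4) subgraph_cycle_of_iff[OF assms(1), of p] vs[of "last p" "hd p"]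
    by (auto simp: adj)
  show ?thesis
    using assms(4) sub unfolding cycle_lists_def set_filter set_paths_above_last by auto
qed

text \<open>Replaces the quantification over arbitrary vertex lists by a computable list; the normal
  form shows that no cycle is missed.\<close>

lemma cycles_of_length_conv_cycle_lists:
  assumes "simple_graph G" "verts G = set vs" "\<And>u v. {u, v} \<in> edges G \<longleftrightarrow> v \<in> set (N u)" "3 \<le> n"
  shows "cycles_of_length n G = cycle_of ` set (cycle_lists vs N n)"
proof (intro set_eqI iffI)
  fix C
  assume "C \<in> cycles_of_length n G"
  then obtain xs where xs: "C = cycle_of xs" "distinct xs" "3 \<le> length xs" "length xs = n"
      "subgraph (cycle_of xs) G"
    by (auto simp: cycles_of_length_conv)
  obtain ys where "cycle_of ys = cycle_of xs" "distinct ys" "length ys = length xs"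
      "\<forall>y \<in> set (butlast ys). last ys < y" "hd ys < last (butlast ys)"
    by (rule cycle_of_normal_form[OF xs(2,3)])
  then have "C = cycle_of ys" "ys \<in> set (cycle_lists vs N n)"
    using xs assms(4) by (simp_all add: set_cycle_lists[OF assms(1-3)])
  then show "C \<in> cycle_of ` set (cycle_lists vs N n)"
    by (rule image_eqI)
next
  fix C
  assume "C \<in> cycle_of ` set (cycle_lists vs N n)"
  then show "C \<in> cycles_of_length n G"
    using assms(4) by (auto simp: cycles_of_length_conv set_cycle_lists[OF assms(1-3)])
qed

text \<open>A cycle determines its vertex set and hence the sorted list of its vertices, so pairwise
  different sorted lists come from different cycles.\<close>

lemma card_cycle_of_image:
  fixes ps :: "'a::linorder list list"
  assumes "distinct (map sort ps)" "\<And>p. p \<in> set ps \<Longrightarrow> distinct p"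
  shows "card (cycle_of ` set ps) = length ps"
proof -
  have "p = q" if "p \<in> set ps" "q \<in> set ps" "cycle_of p = cycle_of q" for p q
  proof -
    have "set p = set q"
      using arg_cong[OF that(3), of verts] by simp
    then have "sort p = sort q"
      using that(1,2) assms(2) by (metis distinct_remdups_id sorted_list_of_set_sort_remdups)
    moreover have "inj_on sort (set ps)"
      using assms(1) by (simp add: distinct_map)
    ultimately show ?thesis
      using that(1,2) by (blast dest: inj_onD)
  qed
  then have "card (cycle_of ` set ps) = card (set ps)"
    by (intro card_image inj_onI)
  also have "\<dots> = length ps"
    using assms(1) by (simp add: distinct_map distinct_card)
  finally show ?thesis .
qed

text \<open>The cycle has as many vertices and edges as there are colors, and all their colors lie
  in \<open>K\<close>, so injectivity alone gives the bijections.\<close>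

lemma rainbow_cycle_of_iff:
  assumes col: "total_coloring G K vc ec" and sub: "subgraph (cycle_of xs) G"
    and xs: "distinct xs" "3 \<le> length xs" "length xs = card K" and "finite K"
  shows "rainbow K vc ec (cycle_of xs) \<longleftrightarrow>
    distinct (map vc xs) \<and> distinct (map ec (cycle_edge_list xs))"
proof -
  have bij: "bij_betw f A K \<longleftrightarrow> inj_on f A" if "f ` A \<subseteq> K" "card A = card K"
    for f :: "'z \<Rightarrow> 'b" and A
    using that card_image[of f A] card_subset_eq[OF \<open>finite K\<close>] by (auto simp: bij_betw_def)
  have "vc ` set xs \<subseteq> K" "ec ` edges (cycle_of xs) \<subseteq> K"
    using col sub by (auto simp: total_coloring_def subgraph_def)
  then show ?thesis
    using xs card_edges_cycle_of[OF xs(1,2)] distinct_cycle_edge_list[OF xs(1,2)]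
    by (simp add: rainbow_def bij distinct_card distinct_map) (simp add: cycle_of_def)
qed

section \<open>The Petersen graph\<close>

lemma edges_petersen_iff:
  assumes "A \<in> verts petersen" "B \<in> verts petersen"
  shows "{A, B} \<in> edges petersen \<longleftrightarrow> A \<inter> B = {}"
  using assms by (auto simp: petersen_def doubleton_eq_iff)

text \<open>Surjectivity comes from counting: the Petersen graph also has 5 choose 2, that is 10,
  vertices.\<close>

lemma graph_iso_petersenI:
  assumes "card (verts G) = 10" "inj_on f (verts G)" "f ` verts G \<subseteq> verts petersen"
    "\<And>u v. u \<in> verts G \<Longrightarrow> v \<in> verts G \<Longrightarrow> {u, v} \<in> edges G \<longleftrightarrow> f u \<inter> f v = {}"
  shows "graph_iso G petersen"
proof -
  have fin: "finite (verts petersen)"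
    by (simp add: petersen_def)
  have "card (verts petersen) = 10"
    by (simp add: petersen_def n_subsets) (simp add: choose_two)
  then have "f ` verts G = verts petersen"
    using assms(1-3) card_image by (metis card_subset_eq[OF fin])
  then have "bij_betw f (verts G) (verts petersen)"
    using assms(2) by (simp add: bij_betw_def)
  moreover have "{u, v} \<in> edges G \<longleftrightarrow> {f u, f v} \<in> edges petersen"
    if "u \<in> verts G" "v \<in> verts G" for u v
    using that assms(3) by (subst edges_petersen_iff) (auto simp: assms(4))
  ultimately show ?thesis
    unfolding graph_iso_def by blast
qed

section \<open>The graph \<open>\<Gamma>\<close>\<close>

text \<open>Pentagons join even vertices at distance 4, pentagrams odd ones at distance 8. Adding 19
  or \<open>20 - k\<close> subtracts 1 or \<open>k\<close> modulo 20.\<close>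

definition Gamma_nbrs :: "nat \<Rightarrow> nat list" where
  "Gamma_nbrs v = (if v < 20 then
     let k = if even v then 4 else 8
     in [(v + 1) mod 20, (v + 19) mod 20, (v + k) mod 20, (v + (20 - k)) mod 20] else [])"

lemma verts_Gamma: "verts Gamma = set [0..<20]"
  by code_simp

lemma simple_graph_Gamma: "simple_graph Gamma"
proof -
  have "\<forall>e \<in> edges Gamma. e \<subseteq> set [0..<20] \<and> card e = 2"
    unfolding edges_Gamma by code_simp
  then show ?thesis
    by (simp add: simple_graph_def verts_Gamma)
qed

text \<open>Closure confines edges to the vertex set, distinctness yields the degree, and the last
  clause makes \<open>vcol\<close> proper.\<close>

lemma Gamma_nbrs_props:
  "\<forall>v \<in> set [0..<20]. set (Gamma_nbrs v) \<subseteq> set [0..<20] \<and> distinct (Gamma_nbrs v) \<and>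
     (\<forall>u \<in> set (Gamma_nbrs v). vcol u \<noteq> vcol v)"
  by code_simp

lemma edge_Gamma_iff: "{u, v} \<in> edges Gamma \<longleftrightarrow> v \<in> set (Gamma_nbrs u)"
proof (cases "u < 20 \<and> v < 20")
  case True
  have "\<forall>u \<in> set [0..<20]. \<forall>v \<in> set [0..<20]. {u, v} \<in> edges Gamma \<longleftrightarrow> v \<in> set (Gamma_nbrs u)"
    unfolding edges_Gamma by code_simp
  with True show ?thesis
    by simp
next
  case False
  \<comment> \<open>Outside the vertex range both sides are false, so the equivalence holds for all
    natural numbers.\<close>
  then have "{u, v} \<notin> edges Gamma"
    using simple_graph_Gamma by (auto simp: simple_graph_def verts_Gamma)
  moreover have "v \<notin> set (Gamma_nbrs u)"
  proof (cases "u < 20")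
    case True
    with False Gamma_nbrs_props show ?thesis
      by fastforce
  qed (simp add: Gamma_nbrs_def)
  ultimately show ?thesis
    by simp
qed

lemma nbhd_Gamma: "v < 20 \<Longrightarrow> nbhd Gamma v = set (Gamma_nbrs v)"
  using Gamma_nbrs_props by (fastforce simp: nbhd_def edge_Gamma_iff verts_Gamma)

lemma regular_Gamma: "regular 4 Gamma"
proof -
  have "card (set (Gamma_nbrs v)) = 4" if "v < 20" for v
  proof -
    have "distinct (Gamma_nbrs v)"
      using that Gamma_nbrs_props by simp
    then show ?thesis
      using that by (subst distinct_card) (simp_all add: Gamma_nbrs_def Let_def)
  qed
  then show ?thesis
    by (simp add: regular_def verts_Gamma nbhd_Gamma)
qed

text \<open>Walking along \<open>Sigma_cycle\<close> from 0 reaches every vertex, and reachability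
  is symmetric.\<close>

lemma graph_connected_Gamma: "graph_connected Gamma"
proof -
  let ?R = "{(x, y). {x, y} \<in> edges Gamma}"
  have "\<forall>v \<in> set [0..<19]. Suc v \<in> set (Gamma_nbrs v)"
    by code_simp
  then have step: "{v, Suc v} \<in> edges Gamma" if "v < 19" for v
    using that by (simp add: edge_Gamma_iff)
  have reach: "(0, v) \<in> ?R\<^sup>*" if "v < 20" for v
    using that
  proof (induction v)
    case (Suc v)
    then have "(0, v) \<in> ?R\<^sup>*" "(v, Suc v) \<in> ?R"
      using step by simp_all
    then show ?case
      by (rule rtrancl_into_rtrancl)
  qed simp
  have "sym (?R\<^sup>*)"
    by (intro sym_rtrancl symI) (simp add: insert_commute)
  then have "(u, v) \<in> ?R\<^sup>*" if "u < 20" "v < 20" for u v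
    using reach[OF that(1)] reach[OF that(2)] by (meson rtrancl_trans symD)
  then show ?thesis
    by (auto simp: graph_connected_def verts_Gamma)
qed

section \<open>The decomposition of \<open>Gamma\<close> and its Petersen subgraphs\<close>

lemma edge_disjoint_decomposition:
  "sorted_wrt (\<lambda>G H. edges G \<inter> edges H = {}) [Sigma_cycle, P 0, P 1, Q 0, Q 1]"
  by code_simp

lemma hamilton_cycle_Sigma: "hamilton_cycle Sigma_cycle Gamma"
proof -
  have "is_cycle Sigma_cycle"
    unfolding is_cycle_def Sigma_cycle_def by (rule exI[of _ Sigma_vs]) (simp add: Sigma_vs_def)
  moreover have "subgraph Sigma_cycle Gamma"
    by (auto simp: subgraph_def Gamma_def graph_union_def)
  moreover have "verts Sigma_cycle = verts Gamma"
    by (simp add: verts_Gamma Sigma_cycle_def Sigma_vs_def)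
  ultimately show ?thesis
    by (simp add: hamilton_cycle_def cycles_def)
qed

lemma P_Q_five_cycles:
  assumes "i \<in> {0, 1}"
  shows "P i \<in> cycles_of_length 5 Gamma" "Q i \<in> cycles_of_length 5 Gamma"
proof -
  have "subgraph (P i) Gamma" "subgraph (Q i) Gamma"
    using assms by (auto simp: subgraph_def Gamma_def graph_union_def)
  moreover have "distinct (P_vs i)" "length (P_vs i) = 5" "distinct (Q_vs i)" "length (Q_vs i) = 5"
    by (simp_all add: P_vs_def Q_vs_def)
  ultimately show "P i \<in> cycles_of_length 5 Gamma" "Q i \<in> cycles_of_length 5 Gamma"
    unfolding cycles_of_length_conv P_def Q_def by force+
qed

lemma edges_Sigma_cycle: "edges Sigma_cycle = F 0 0 \<union> F 0 1 \<union> F 1 0 \<union> F 1 1"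
  by code_simp

text \<open>The pentagon \<open>P i\<close> carries the labels \<open>{2k, 2k + 1}\<close> modulo 5, and the vertex matched by
  \<open>F i j\<close> with the \<open>k\<close>-th one is labelled \<open>{2k + 2, 2k + 4}\<close>. Division by 4 gives the same \<open>k\<close>
  on both ends of an edge of \<open>F i j\<close>, except for \<open>F 0 1\<close>, where a shift by 1 corrects this.\<close>

definition petersen_label :: "nat \<Rightarrow> nat \<Rightarrow> nat \<Rightarrow> nat set" where
  "petersen_label i j v =
     (let k = (v + (1 - i) * j) div 4
      in if even v then {2 * k mod 5, (2 * k + 1) mod 5} else {(2 * k + 2) mod 5, (2 * k + 4) mod 5})"

text \<open>Adjacency is phrased as an equation between finite sets, so that evaluation decides
  it.\<close>

lemma petersen_label_props:
  "\<forall>i \<in> {0, 1}. \<forall>j \<in> {0, 1}. let G = P i \<union>\<^sub>g Q j \<union>\<^sub>g edge_graph (F i j) in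
     subgraph G Gamma \<and> card (verts G) = 10 \<and>
     (\<forall>u \<in> verts G. petersen_label i j u \<subseteq> {0..<5} \<and> card (petersen_label i j u) = 2) \<and>
     (\<forall>u \<in> verts G. \<forall>v \<in> verts G. petersen_label i j u = petersen_label i j v \<longrightarrow> u = v) \<and>
     edges G = (\<lambda>(u, v). {u, v}) `
       Set.filter (\<lambda>(u, v). petersen_label i j u \<inter> petersen_label i j v = {}) (verts G \<times> verts G)"
  by code_simp

lemma petersen_subgraph:
  assumes "i \<in> {0, 1}" "j \<in> {0, 1}"
  shows "subgraph (P i \<union>\<^sub>g Q j \<union>\<^sub>g edge_graph (F i j)) Gamma"
    and "graph_iso (P i \<union>\<^sub>g Q j \<union>\<^sub>g edge_graph (F i j)) petersen"
proof -
  let ?G = "P i \<union>\<^sub>g Q j \<union>\<^sub>g edge_graph (F i j)"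
  let ?f = "petersen_label i j"
  note props = petersen_label_props[unfolded Let_def, THEN bspec, THEN bspec, OF assms]
  show "subgraph ?G Gamma"
    using props by blast
  have edges: "edges ?G = (\<lambda>(u, v). {u, v}) `
      Set.filter (\<lambda>(u, v). ?f u \<inter> ?f v = {}) (verts ?G \<times> verts ?G)"
    using props by blast
  show "graph_iso ?G petersen"
  proof (rule graph_iso_petersenI[where f = ?f])
    show "inj_on ?f (verts ?G)"
      using props by (intro inj_onI) blast
    show "?f ` verts ?G \<subseteq> verts petersen"
      using props by (auto simp: petersen_def)
    show "{u, v} \<in> edges ?G \<longleftrightarrow> ?f u \<inter> ?f v = {}" if "u \<in> verts ?G" "v \<in> verts ?G" for u v
      \<comment> \<open>Disjointness of labels is symmetric, so it does not matter which ordered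
        pair represents the edge.\<close>
      unfolding edges using that by (force simp: doubleton_eq_iff)
  qed (use props in blast)
qed

section \<open>The coloring and the five-cycles\<close>

lemma total_coloring_Gamma: "total_coloring Gamma {0..4} vcol ecol"
proof -
  have "\<forall>e \<in> edges Gamma. ecol e \<le> 4 \<and> (\<forall>v \<in> e. ecol e \<noteq> vcol v) \<and>
      (\<forall>f \<in> edges Gamma. e \<noteq> f \<and> e \<inter> f \<noteq> {} \<longrightarrow> ecol e \<noteq> ecol f)"
    unfolding edges_Gamma by code_simp
  moreover have "vcol v \<le> 4" for v
    by (simp add: vcol_def)
  moreover have "vcol u \<noteq> vcol v" if "u \<in> verts Gamma" "{u, v} \<in> edges Gamma" for u v
    using that Gamma_nbrs_props by (fastforce simp: edge_Gamma_iff verts_Gamma)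
  ultimately show ?thesis
    unfolding total_coloring_def by simp
qed

lemma not_efficient_total_coloring_Gamma: "\<not> efficient_total_coloring Gamma 4 vcol ecol"
proof -
  \<comment> \<open>The neighbours 4 and 19 of 0 both have color 3.\<close>
  have "{4, 19} \<subseteq> closed_nbhd Gamma 0" "vcol 4 = vcol 19"
    by (simp_all add: closed_nbhd_def nbhd_Gamma Gamma_nbrs_def vcol_def)
  then have "\<not> inj_on vcol (closed_nbhd Gamma 0)"
    by (auto dest: inj_onD[of _ _ 4 19])
  moreover have "0 \<in> verts Gamma"
    by (simp add: verts_Gamma)
  ultimately show ?thesis
    by (auto simp: efficient_total_coloring_def)
qed

section \<open>Girth and the count of five-cycles\<close>

abbreviation Gamma_cycle_lists :: "nat \<Rightarrow> nat list list" where
  "Gamma_cycle_lists \<equiv> cycle_lists [0..<20] Gamma_nbrs"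

lemmas Gamma_cycles_conv =
  cycles_of_length_conv_cycle_lists[OF simple_graph_Gamma verts_Gamma edge_Gamma_iff]

text \<open>The enumeration finds no cycle of length 3 or 4, and the pentagon \<open>P 0\<close>
  attains 5.\<close>

lemma girth_Gamma: "girth Gamma = 5"
proof -
  have "Gamma_cycle_lists 3 = []" "Gamma_cycle_lists 4 = []"
    by code_simp+
  then have no_short: "cycles_of_length 3 Gamma = {}" "cycles_of_length 4 Gamma = {}"
    by (simp_all add: Gamma_cycles_conv)
  have "5 \<le> card (edges C)" if "C \<in> cycles Gamma" for C
  proof -
    have "3 \<le> card (edges C)"
      using that by (auto simp: cycles_def is_cycle_def card_edges_cycle_of)
    moreover have "card (edges C) \<noteq> 3" "card (edges C) \<noteq> 4"
      using that no_short by (auto simp: cycles_of_length_def)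
    ultimately show ?thesis
      by linarith
  qed
  moreover have "P 0 \<in> cycles Gamma" "card (edges (P 0)) = 5"
    using P_Q_five_cycles(1)[of 0] by (simp_all add: cycles_of_length_def)
  ultimately have "girth Gamma = enat 5"
    unfolding girth_def by (intro antisym INF_lower2[of "P 0"] INF_greatest) simp_all
  then show ?thesis
    by (simp add: numeral_eq_enat)
qed

lemma Gamma_five_cycle_lists:
  "distinct (map sort (Gamma_cycle_lists 5)) \<and> length (Gamma_cycle_lists 5) = 54 \<and>
   length (filter (\<lambda>p. distinct (map vcol p) \<and> distinct (map ecol (cycle_edge_list p)))
     (Gamma_cycle_lists 5)) = 14"
  by code_simp

text \<open>The free predicate \<open>R\<close> serves both counts: constantly true for all
  five-cycles, and the color test for the rainbow ones.\<close>

lemma card_cycle_of_image_Gamma: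
  "card (cycle_of ` set (filter R (Gamma_cycle_lists 5))) = length (filter R (Gamma_cycle_lists 5))"
proof (rule card_cycle_of_image)
  show "distinct (map sort (filter R (Gamma_cycle_lists 5)))"
    using Gamma_five_cycle_lists by (intro distinct_map_filter) (rule conjunct1)
next
  fix p
  assume "p \<in> set (filter R (Gamma_cycle_lists 5))"
  then show "distinct p"
    by (simp add: set_cycle_lists[OF simple_graph_Gamma verts_Gamma edge_Gamma_iff])
qed

lemma five_cycles_conv: "cycles_of_length 5 Gamma = cycle_of ` set (Gamma_cycle_lists 5)"
  by (rule Gamma_cycles_conv) simp

lemma card_five_cycles: "card (cycles_of_length 5 Gamma) = 54"
proof -
  have "cycles_of_length 5 Gamma = cycle_of ` set (filter (\<lambda>_. True) (Gamma_cycle_lists 5))"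
    by (metis five_cycles_conv filter_True)
  also have "card \<dots> = length (Gamma_cycle_lists 5)"
    by (subst card_cycle_of_image_Gamma) simp
  also have "\<dots> = 54"
    using Gamma_five_cycle_lists by (elim conjE)
  finally show ?thesis .
qed

lemma card_rainbow_five_cycles:
  "card {C \<in> cycles_of_length 5 Gamma. rainbow {0..4} vcol ecol C} = 14"
proof -
  let ?L = "Gamma_cycle_lists 5"
  let ?R = "\<lambda>p. distinct (map vcol p) \<and> distinct (map ecol (cycle_edge_list p))"
  have "rainbow {0..4} vcol ecol (cycle_of p) \<longleftrightarrow> ?R p" if "p \<in> set ?L" for p
    using that
    \<comment> \<open>The criterion applies because there are five colors and each listed cycle has
      five vertices.\<close>
    by (intro rainbow_cycle_of_iff[OF total_coloring_Gamma])
      (simp_all add: set_cycle_lists[OF simple_graph_Gamma verts_Gamma edge_Gamma_iff])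
  then have "{C \<in> cycles_of_length 5 Gamma. rainbow {0..4} vcol ecol C} =
      cycle_of ` set (filter ?R ?L)"
    unfolding five_cycles_conv by auto
  also have "card \<dots> = length (filter ?R ?L)"
    by (rule card_cycle_of_image_Gamma)
  also have "\<dots> = 14"
    using Gamma_five_cycle_lists by (elim conjE)
  finally show ?thesis .
qed

lemma card_non_rainbow_five_cycles:
  "card {C \<in> cycles_of_length 5 Gamma. \<not> rainbow {0..4} vcol ecol C} = 40"
proof -
  let ?A = "cycles_of_length 5 Gamma"
  have "{C \<in> ?A. \<not> rainbow {0..4} vcol ecol C} = ?A - {C \<in> ?A. rainbow {0..4} vcol ecol C}"
    by auto
  moreover have "finite ?A"
    unfolding five_cycles_conv by (intro finite_imageI finite_set)
  ultimately show ?thesis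
    by (simp add: card_Diff_subset card_five_cycles card_rainbow_five_cycles)
qed

theorem theorem35:
  shows
    "sorted_wrt (\<lambda>G H. edges G \<inter> edges H = {}) [Sigma_cycle, P 0, P 1, Q 0, Q 1] \<and>
     hamilton_cycle Sigma_cycle Gamma \<and>
     (\<forall>i \<in> {0, 1}. P i \<in> cycles_of_length 5 Gamma \<and> Q i \<in> cycles_of_length 5 Gamma) \<and>
     simple_graph Gamma \<and> graph_connected Gamma \<and>
     card (verts Gamma) = 20 \<and> regular 4 Gamma \<and> girth Gamma = 5 \<and>
     edges Sigma_cycle = F 0 0 \<union> F 0 1 \<union> F 1 0 \<union> F 1 1 \<and>
     (\<forall>i \<in> {0, 1}. \<forall>j \<in> {0, 1}.
        subgraph (P i \<union>\<^sub>g Q j \<union>\<^sub>g edge_graph (F i j)) Gamma \<and>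
        graph_iso (P i \<union>\<^sub>g Q j \<union>\<^sub>g edge_graph (F i j)) petersen) \<and>
     total_coloring Gamma {0..4} vcol ecol \<and>
     \<not> efficient_total_coloring Gamma 4 vcol ecol \<and>
     card (cycles_of_length 5 Gamma) = 54 \<and>
     card {C \<in> cycles_of_length 5 Gamma. rainbow {0..4} vcol ecol C} = 14 \<and>
     card {C \<in> cycles_of_length 5 Gamma. \<not> rainbow {0..4} vcol ecol C} = 40"
  using edge_disjoint_decomposition hamilton_cycle_Sigma P_Q_five_cycles simple_graph_Gamma
    graph_connected_Gamma regular_Gamma girth_Gamma edges_Sigma_cycle petersen_subgraph
    total_coloring_Gamma not_efficient_total_coloring_Gamma card_five_cycles
    card_rainbow_five_cycles card_non_rainbow_five_cycles
  by (intro conjI ballI) (simp_all add: verts_Gamma)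

end
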